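(* Let $\mathcal{P}=(p_1,p_2,\dots)$ be a probability distribution on $\mathbb{N}$ with $p_1\ge p_2\ge p_3\ge\cdots$ and with unbounded support, and consider the Binary Flipping (BF) model with distribution $\mathcal{P}$ and return time $\tau_{\mathrm{BF}}$ to the ground state. (i) If $\limsup_{k\to\infty}2^k p_k<\infty$, then the BF model is recurrent, i.e. $\mathbf{P}(\tau_{\mathrm{BF}}<\infty)=1$. (ii) If $\liminf_{k\to\infty}(2-\varepsilon)^k p_k>0$ for some $\varepsilon>0$, then the BF model is transient, i.e. $\mathbf{P}(\tau_{\mathrm{BF}}=\infty)>0$.
   Context: $\mathbb{N}=\{1,2,\dots\}$. Binary Flipping (BF) model: let $\chi_1,\chi_2,\dots$ be i.i.d. random variables with $\mathbf{P}(\chi_i=k)=p_k$, $k\in\mathbb{N}$. The BF model is the discrete-time Markov chain $\zeta_n=(\zeta_n^1,\zeta_n^2,\dots)$, $n\ge 0$, with values in $\mathcal{X}=\{x\in\{0,1\}^{\mathbb{N}}: x\text{ has finitely many non-zeros}\}$, started from the ground state $\zeta_0=\mathbf{0}=(0,0,\dots)$, with $$\zeta^k_{n+1}=\begin{cases}\zeta^k_n,& k\ne\chi_{n+1},\\ 1-\zeta^k_n,& k=\chi_{n+1},\end{cases}\qquad k\in\mathbb{N},\ n\ge 0.$$ Here $\zeta_n^k=0$ means bit $k$ is idle at step $n$ and $\zeta_n^k=1$ means it is active. The return time is $\tau_{\mathrm{BF}}=\min\{n\ge 1:\zeta_n^k=0\ \text{for all }k\in\mathbb{N}\}$, with $\tau_{\mathrm{BF}}=\infty$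 if no such $n$ exists. *)

theory Defs
  imports "HOL-Probability.Probability"
begin

text \<open>
  The positive integers are rendered as the set \<open>{1..}\<close> of type \<^typ>\<open>nat\<close>, so index 0 is a junk
  position that all notions below ignore. A trajectory of the model is a function of the
  sequence \<open>c\<close> of chosen bits, where \<open>c i\<close> is the bit flipped in step \<open>i \<ge> 1\<close>.
\<close>

definition bf_states :: "(nat \<Rightarrow> nat) set" where
  "bf_states = {x. (\<forall>k\<ge>1. x k \<in> {0, 1}) \<and> finite {k. k \<ge> 1 \<and> x k \<noteq> 0}}"

primrec bf_chain :: "(nat \<Rightarrow> nat) \<Rightarrow> nat \<Rightarrow> nat \<Rightarrow> nat" where
  "bf_chain c 0 = (\<lambda>k. 0)"
| "bf_chain c (Suc n) = (\<lambda>k. if k = c (Suc n) then 1 - bf_chain c n k else bf_chain c n k)"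

text \<open>The infimum of the empty set in \<^typ>\<open>enat\<close> is \<open>\<infinity>\<close>.\<close>

definition bf_return_time :: "(nat \<Rightarrow> nat) \<Rightarrow> enat" where
  "bf_return_time c = Inf (enat ` {n. n \<ge> 1 \<and> (\<forall>k\<ge>1. bf_chain c n k = 0)})"

lemma bf_chain_in_states: "bf_chain c n \<in> bf_states"
proof (induction n)
  case 0
  show ?case by (simp add: bf_states_def)
next
  case (Suc n)
  have "{k. k \<ge> 1 \<and> bf_chain c (Suc n) k \<noteq> 0}
      \<subseteq> insert (c (Suc n)) {k. k \<ge> 1 \<and> bf_chain c n k \<noteq> 0}"
    by auto
  moreover have "finite (insert (c (Suc n)) {k. k \<ge> 1 \<and> bf_chain c n k \<noteq> 0})"
    using Suc by (simp add: bf_states_def)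
  ultimately have "finite {k. k \<ge> 1 \<and> bf_chain c (Suc n) k \<noteq> 0}"
    by (rule finite_subset)
  moreover have "\<forall>k\<ge>1. bf_chain c (Suc n) k \<in> {0, 1}"
    using Suc by (auto simp: bf_states_def)
  ultimately show ?case
    unfolding bf_states_def by blast
qed

end

theory Submission
  imports Defs
begin

text \<open>
  Let \<open>u n\<close> be the probability that the chain is in the ground state at time \<open>n\<close>. The bits are
  flipped independently of the past, so the chain starts afresh at its first return, and \<open>u\<close>
  satisfies a renewal equation whose increments are the probabilities of the first return times.
  Hence the chain is recurrent if and only if the series of \<open>u\<close> diverges
  (\<open>recurrent_iff_return_prob_not_summable\<close>).

  The probabilities \<open>u n\<close> come from Fourier analysis on the group of subsets. The character of a
  finite set \<open>S\<close> of bits changes its sign whenever a bit of \<open>S\<close> is flipped, so its expectation at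
  time \<open>n\<close> is \<open>(1 - 2 * sum p S) ^ n\<close>. The indicator of the event that the first \<open>N\<close> bits are
  idle is the average of the characters of the subsets \<open>S\<close> of \<open>{1..N}\<close>. Thus \<open>u n\<close> is the
  limit, as \<open>N\<close> grows, of the mean of \<open>(1 - 2 * sum p S) ^ n\<close> over a uniformly random such \<open>S\<close>
  (\<open>prob_first_bits_idle\<close>, \<open>walsh_return_tendsto\<close>). The question is therefore how likely the
  random weight \<open>X = sum p S\<close> is to be small: formally, the series of \<open>u\<close> is the expectation
  of \<open>1 / (2 * X)\<close>.

  If \<open>p k \<le> C / 2 ^ k\<close>, then \<open>S\<close> avoids the first \<open>j\<close> bits with probability \<open>1 / 2 ^ j\<close>, and then
  \<open>X \<le> C / 2 ^ j\<close>. At time \<open>2 * m\<close>, the choice of \<open>j\<close> with \<open>2 ^ j\<close> of order \<open>m\<close> gives a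
  contribution of order \<open>1 / m\<close>, and the harmonic series diverges
  (\<open>return_prob_not_summable\<close>).

  If \<open>p k\<close> is at least a constant times \<open>(2 - \<epsilon>) powr (- k)\<close>, then \<open>X \<ge> p k\<close> on the event, of
  probability \<open>1 / 2 ^ k\<close>, that \<open>k\<close> is the smallest element of \<open>S\<close>. So the mean of \<open>1 / X\<close> is
  at most the sum of \<open>1 / (2 ^ k * p k)\<close>, which converges (\<open>return_prob_summable\<close>).
\<close>

section \<open>Renewal sequences\<close>

text \<open>
  Summing the renewal equation gives \<open>U = 1 + F * U\<close> for the totals \<open>U\<close> of \<open>u\<close> and \<open>F\<close> of \<open>f\<close>.
  If \<open>U\<close> is finite, this excludes \<open>F = 1\<close>. If \<open>F < 1\<close>, then the same computation for partial sums,
  where the triangle of index pairs is enlarged to a square, bounds them by \<open>1 / (1 - F)\<close>.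
\<close>

lemma renewal_recurrent_iff:
  fixes u f :: "nat \<Rightarrow> real"
  assumes u0: "u 0 = 1" and u_nonneg: "\<And>n. u n \<ge> 0"
    and f_nonneg: "\<And>n. f n \<ge> 0" and f_summable: "summable f" and f_le: "suminf f \<le> 1"
    and renewal: "\<And>n. n \<ge> 1 \<Longrightarrow> u n = (\<Sum>k\<le>n. f k * u (n - k))"
    and f0: "f 0 = 0"
  shows "suminf f = 1 \<longleftrightarrow> \<not> summable u"
proof
  have conv: "(\<Sum>k\<le>n. f k * u (n - k)) = u n - (if n = 0 then 1 else 0)" for n
    using renewal[of n] u0 f0 by (cases "n = 0") auto
  show "\<not> summable u" if "suminf f = 1"
  proof
    assume u_summable: "summable u"
    have "(\<lambda>n. u n - (if n = 0 then 1 else 0)) sums (suminf f * suminf u)"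
      using Cauchy_product_sums[of f u] f_summable u_summable u_nonneg f_nonneg by (simp add: conv)
    moreover have "(\<lambda>n. u n - (if n = 0 then 1 else 0)) sums (suminf u - 1)"
      using sums_diff[OF summable_sums[OF u_summable] sums_single[of 0 "\<lambda>_. 1::real"]]
      by (simp add: eq_commute)
    ultimately have "suminf f * suminf u = suminf u - 1"
      by (rule sums_unique2)
    with that show False by simp
  qed
  show "suminf f = 1" if not_sum: "\<not> summable u"
  proof (rule ccontr)
    assume "suminf f \<noteq> 1"
    then have F1: "suminf f < 1" using f_le by simp
    have bound: "sum u {..n} \<le> 1 / (1 - suminf f)" for n
    proof -
      have "sum u {..n} - 1 = (\<Sum>m\<le>n. u m - (if m = 0 then 1 else 0))"
        by (simp add: sum_subtractf)
      also have "\<dots> = (\<Sum>m\<le>n. \<Sum>k\<le>m. f k * u (m - k))"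
        by (simp add: conv)
      also have "\<dots> = (\<Sum>(i, j)\<in>{(i, j). i + j \<le> n}. f i * u j)"
        by (rule sum.triangle_reindex_eq[symmetric])
      also have "\<dots> \<le> (\<Sum>(i, j)\<in>{..n} \<times> {..n}. f i * u j)"
        by (rule sum_mono2) (auto simp: f_nonneg u_nonneg)
      also have "\<dots> = sum f {..n} * sum u {..n}"
        by (simp add: sum_product sum.cartesian_product)
      also have "\<dots> \<le> suminf f * sum u {..n}"
        by (intro mult_right_mono sum_le_suminf f_summable sum_nonneg) (auto simp: f_nonneg u_nonneg)
      finally have "sum u {..n} * (1 - suminf f) \<le> 1"
        by (simp add: algebra_simps)
      then show ?thesis using F1 by (simp add: field_simps)
    qed
    have "summable u"
    proof (rule bounded_imp_summable)
      show "u n \<ge> 0" for n by (rule u_nonneg)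
      show "sum u {..n} \<le> 1 / (1 - suminf f)" for n by (rule bound)
    qed
    with not_sum show False ..
  qed
qed

section \<open>The deterministic dynamics\<close>

lemma bf_chain_le_one: "bf_chain c n k \<le> 1"
  by (induction n) auto

text \<open>
  The state at time \<open>n\<close> depends only on the first \<open>n\<close> choices. This lets events about the past and
  the future be transferred to the finitely many coordinates on which independence is available.
\<close>

lemma bf_chain_cong:
  assumes "\<And>i. i \<in> {1..n} \<Longrightarrow> c i = d i"
  shows "bf_chain c n = bf_chain d n"
  using assms by (induction n) auto

definition at_ground :: "(nat \<Rightarrow> nat) \<Rightarrow> nat \<Rightarrow> bool" where
  "at_ground c n \<longleftrightarrow> (\<forall>k\<ge>1. bf_chain c n k = 0)"

definition first_return :: "(nat \<Rightarrow> nat) \<Rightarrow> nat \<Rightarrow> bool" where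
  "first_return c n \<longleftrightarrow> n \<ge> 1 \<and> at_ground c n \<and> (\<forall>j\<in>{1..<n}. \<not> at_ground c j)"

lemma at_ground_0: "at_ground c 0"
  by (simp add: at_ground_def)

lemma at_ground_cong:
  assumes "\<And>i. i \<in> {1..n} \<Longrightarrow> c i = d i"
  shows "at_ground c n \<longleftrightarrow> at_ground d n"
  unfolding at_ground_def using bf_chain_cong[OF assms] by simp

lemma first_return_cong:
  assumes "\<And>i. i \<in> {1..n} \<Longrightarrow> c i = d i"
  shows "first_return c n \<longleftrightarrow> first_return d n"
proof -
  have "at_ground c j \<longleftrightarrow> at_ground d j" if "j \<le> n" for j
    using that by (intro at_ground_cong assms) auto
  then show ?thesis
    unfolding first_return_def by (auto dest: less_imp_le)
qed

lemma at_ground_restart: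
  assumes "at_ground c k"
  shows "at_ground c (k + m) \<longleftrightarrow> at_ground (\<lambda>i. c (k + i)) m"
proof -
  have "\<forall>b\<ge>1. bf_chain c (k + m) b = bf_chain (\<lambda>i. c (k + i)) m b"
    using assms by (induction m) (auto simp: at_ground_def)
  then show ?thesis by (simp add: at_ground_def)
qed

lemma first_return_unique:
  "first_return c m \<Longrightarrow> first_return c n \<Longrightarrow> m = n"
  unfolding first_return_def by (metis atLeastLessThan_iff nat_neq_iff)

lemma first_return_exists:
  assumes "n \<ge> 1" "at_ground c n"
  shows "\<exists>k\<le>n. first_return c k"
proof -
  let ?P = "\<lambda>k. k \<ge> 1 \<and> at_ground c k"
  define k where "k = (LEAST k. ?P k)"
  have n: "?P n" using assms by simp
  have "?P k" unfolding k_def using n by (rule LeastI)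
  moreover have "\<not> ?P j" if "j < k" for j
    using that unfolding k_def by (rule not_less_Least)
  ultimately have "first_return c k" unfolding first_return_def by simp
  moreover have "k \<le> n" unfolding k_def using n by (rule Least_le)
  ultimately show ?thesis by blast
qed

lemma return_time_finite_iff:
  "bf_return_time c < \<infinity> \<longleftrightarrow> (\<exists>k. first_return c k)"
proof -
  have "bf_return_time c < \<infinity> \<longleftrightarrow> (\<exists>n\<ge>1. at_ground c n)"
    unfolding bf_return_time_def at_ground_def Inf_less_iff by auto
  also have "\<dots> \<longleftrightarrow> (\<exists>k. first_return c k)"
    using first_return_exists unfolding first_return_def by blast
  finally show ?thesis .
qed

text \<open>
  Each flip of a bit in \<open>S\<close> reverses the sign of the character of \<open>S\<close>, and other flips leave it
  alone. The right-hand side is a product over time, so independence can be applied to it.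
\<close>

lemma sign_character_chain:
  assumes "finite S"
  shows "(\<Prod>k\<in>S. (- 1 :: real) ^ bf_chain c n k) = (\<Prod>i=1..n. if c i \<in> S then - 1 else 1)"
proof (induction n)
  case (Suc n)
  have "(- 1 :: real) ^ bf_chain c (Suc n) k
      = (if k = c (Suc n) then - 1 else 1) * (- 1) ^ bf_chain c n k" for k
  proof -
    have "bf_chain c n k = 0 \<or> bf_chain c n k = 1"
      using bf_chain_le_one[of c n k] by linarith
    then show ?thesis by auto
  qed
  then have "(\<Prod>k\<in>S. (- 1 :: real) ^ bf_chain c (Suc n) k)
      = (\<Prod>k\<in>S. if k = c (Suc n) then - 1 else 1) * (\<Prod>k\<in>S. (- 1) ^ bf_chain c n k)"
    by (simp only: prod.distrib)
  also have "(\<Prod>k\<in>S. if k = c (Suc n) then - 1 else 1) = (if c (Suc n) \<in> S then - 1 else (1::real))"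
    using assms by (simp add: prod.delta)
  finally show ?case using Suc by simp
qed simp

text \<open>
  Orthogonality of characters: the product of \<open>1 + (- 1) ^ x k\<close> over \<open>k\<close> vanishes unless all \<open>x k\<close>
  are even, and expanding it yields one character for each subset.
\<close>

lemma ground_indicator_walsh:
  "(if \<forall>k\<in>{1..N}. bf_chain c n k = 0 then 1 else 0 :: real)
     = (\<Sum>S\<in>Pow {1..N}. \<Prod>i=1..n. if c i \<in> S then - 1 else 1) / 2 ^ N"
proof -
  have "(\<Sum>S\<in>Pow {1..N}. \<Prod>i=1..n. if c i \<in> S then - 1 else 1)
      = (\<Sum>S\<in>Pow {1..N}. \<Prod>k\<in>S. (- 1 :: real) ^ bf_chain c n k)"
    by (intro sum.cong refl sign_character_chain[symmetric]) (auto intro: finite_subset)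
  also have "\<dots> = (\<Prod>k=1..N. (- 1) ^ bf_chain c n k + 1)"
    by (simp add: prod_add)
  also have "\<dots> = (if \<forall>k\<in>{1..N}. bf_chain c n k = 0 then 2 ^ N else 0)"
  proof (cases "\<forall>k\<in>{1..N}. bf_chain c n k = 0")
    case False
    then obtain k where k: "k \<in> {1..N}" "bf_chain c n k \<noteq> 0" by auto
    then have "bf_chain c n k = 1" using bf_chain_le_one[of c n k] by linarith
    with k show ?thesis by (auto intro!: prod_zero bexI[of _ k])
  qed simp
  finally show ?thesis by simp
qed

section \<open>The return probabilities\<close>

definition walsh_return :: "(nat \<Rightarrow> real) \<Rightarrow> nat \<Rightarrow> nat \<Rightarrow> real" where
  "walsh_return p N n = (\<Sum>S\<in>Pow {1..N}. (1 - 2 * sum p S) ^ n) / 2 ^ N"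

lemma (in prob_space) indep_vars_reindex:
  assumes inj: "inj_on h I" and ind: "indep_vars M' X (h ` I)"
  shows "indep_vars (\<lambda>i. M' (h i)) (\<lambda>i. X (h i)) I"
  unfolding indep_vars_def2
proof (intro conjI ballI indep_setsI)
  show "random_variable (M' (h i)) (X (h i))" if "i \<in> I" for i
    using ind that unfolding indep_vars_def2 by blast
  then show "{X (h i) -` A \<inter> space M |A. A \<in> sets (M' (h i))} \<subseteq> events" if "i \<in> I" for i
    using that measurable_sets by blast
  fix A J
  assume J: "J \<noteq> {}" "J \<subseteq> I" "finite J"
    and A: "\<forall>j\<in>J. A j \<in> {X (h j) -` B \<inter> space M |B. B \<in> sets (M' (h j))}"
  have inj_J: "inj_on h J" using inj J(2) by (rule inj_on_subset)
  define A' where "A' = (\<lambda>i. A (the_inv_into J h i))"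
  have A': "A' (h j) = A j" if "j \<in> J" for j
    using that inj_J by (simp add: A'_def the_inv_into_f_f)
  have "prob (\<Inter>i\<in>h ` J. A' i) = (\<Prod>i\<in>h ` J. prob (A' i))"
  proof (rule indep_setsD)
    show "indep_sets (\<lambda>i. {X i -` B \<inter> space M |B. B \<in> sets (M' i)}) (h ` I)"
      using ind by (simp add: indep_vars_def2)
    show "\<forall>i\<in>h ` J. A' i \<in> {X i -` B \<inter> space M |B. B \<in> sets (M' i)}"
      using A A' by auto
  qed (use J in auto)
  then show "prob (\<Inter>j\<in>J. A j) = (\<Prod>j\<in>J. prob (A j))"
    using A' inj_J by (simp add: prod.reindex)
qed

locale iid_flips = prob_space M for M :: "'a measure" +
  fixes chi :: "nat \<Rightarrow> 'a \<Rightarrow> nat" and p :: "nat \<Rightarrow> real"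
  assumes indep: "indep_vars (\<lambda>_. count_space {1..}) chi {1..}"
    and law: "\<And>i k. i \<ge> 1 \<Longrightarrow> k \<ge> 1 \<Longrightarrow> measure M {\<omega> \<in> space M. chi i \<omega> = k} = p k"

lemma measurable_bf_chain:
  assumes "\<And>i. i \<in> {1..n} \<Longrightarrow> X i \<in> measurable Q (count_space {1..})"
  shows "(\<lambda>\<omega>. bf_chain (\<lambda>i. X i \<omega>) n k) \<in> measurable Q (count_space UNIV)"
  using assms
proof (induction n)
  case (Suc n)
  have [measurable]: "(\<lambda>\<omega>. bf_chain (\<lambda>i. X i \<omega>) n k) \<in> measurable Q (count_space UNIV)"
    by (rule Suc.IH, rule Suc.prems) auto
  have "X (Suc n) \<in> measurable Q (count_space {1..})"
    by (rule Suc.prems) auto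
  from measurable_compose[OF this, of "\<lambda>x. x" "count_space UNIV"]
  have [measurable]: "X (Suc n) \<in> measurable Q (count_space UNIV)" by simp
  show ?case by simp
qed simp

lemma sets_at_ground:
  assumes "\<And>i. i \<in> {1..n} \<Longrightarrow> X i \<in> measurable Q (count_space {1..})"
  shows "{\<omega> \<in> space Q. at_ground (\<lambda>i. X i \<omega>) n} \<in> sets Q"
proof -
  have [measurable]: "(\<lambda>\<omega>. bf_chain (\<lambda>i. X i \<omega>) n k) \<in> measurable Q (count_space UNIV)" for k
    by (rule measurable_bf_chain[OF assms])
  show ?thesis unfolding at_ground_def by measurable
qed

lemma sets_first_return:
  assumes X: "\<And>i. i \<in> {1..n} \<Longrightarrow> X i \<in> measurable Q (count_space {1..})"
  shows "{\<omega> \<in> space Q. first_return (\<lambda>i. X i \<omega>) n} \<in> sets Q"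
proof -
  have ground: "{\<omega> \<in> space Q. at_ground (\<lambda>i. X i \<omega>) j} \<in> sets Q" if "j \<le> n" for j
    using that by (intro sets_at_ground X) auto
  have "{\<omega> \<in> space Q. \<forall>j\<in>{1..<n}. \<not> at_ground (\<lambda>i. X i \<omega>) j} \<in> sets Q"
    by (intro sets.sets_Collect_finite_All sets.sets_Collect_neg ground) auto
  moreover have "{\<omega> \<in> space Q. at_ground (\<lambda>i. X i \<omega>) n} \<in> sets Q"
    by (rule ground) simp
  ultimately show ?thesis
    unfolding first_return_def by (intro sets.sets_Collect_conj sets.sets_Collect_const)
qed

context iid_flips
begin

lemma chi_measurable: "i \<ge> 1 \<Longrightarrow> chi i \<in> measurable M (count_space {1..})"
  using indep unfolding indep_vars_def by auto

lemma prob_chi_in: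
  assumes "i \<ge> 1" "finite S" "S \<subseteq> {1..}"
  shows "{\<omega> \<in> space M. chi i \<omega> \<in> S} \<in> events" and "prob {\<omega> \<in> space M. chi i \<omega> \<in> S} = sum p S"
proof -
  have ev: "{\<omega> \<in> space M. chi i \<omega> \<in> T} \<in> events" if "T \<subseteq> {1..}" for T
    using measurable_sets[OF chi_measurable[OF assms(1)], of T] that
    by (simp add: vimage_def Int_def conj_commute)
  show "{\<omega> \<in> space M. chi i \<omega> \<in> S} \<in> events" by (rule ev[OF assms(3)])
  have "prob (\<Union>k\<in>S. {\<omega> \<in> space M. chi i \<omega> = k}) = (\<Sum>k\<in>S. prob {\<omega> \<in> space M. chi i \<omega> = k})"
    using assms(2,3) ev[of "{k}" for k]
    by (intro finite_measure_finite_Union) (auto simp: disjoint_family_on_def)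
  also have "\<dots> = sum p S" using assms by (intro sum.cong law) auto
  also have "(\<Union>k\<in>S. {\<omega> \<in> space M. chi i \<omega> = k}) = {\<omega> \<in> space M. chi i \<omega> \<in> S}" by auto
  finally show "prob {\<omega> \<in> space M. chi i \<omega> \<in> S} = sum p S" .
qed

lemma expectation_sign:
  assumes "i \<ge> 1" "finite S" "S \<subseteq> {1..}"
  shows "integrable M (\<lambda>\<omega>. if chi i \<omega> \<in> S then - 1 else 1 :: real)"
    and "expectation (\<lambda>\<omega>. if chi i \<omega> \<in> S then - 1 else 1) = 1 - 2 * sum p S"
proof -
  let ?A = "{\<omega> \<in> space M. chi i \<omega> \<in> S}"
  have A: "?A \<in> events" "prob ?A = sum p S" using prob_chi_in[OF assms] by auto
  have eq: "(if chi i \<omega> \<in> S then - 1 else 1 :: real) = 1 - 2 * indicator ?A \<omega>"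
    if "\<omega> \<in> space M" for \<omega>
    using that by (auto simp: indicator_def)
  have ind: "integrable M (indicator ?A :: _ \<Rightarrow> real)"
    using A(1) by (intro integrable_real_indicator) (simp_all add: emeasure_eq_measure)
  then have "integrable M (\<lambda>\<omega>. 1 - 2 * indicator ?A \<omega> :: real)"
    by (intro Bochner_Integration.integrable_diff integrable_const integrable_mult_right)
  then show "integrable M (\<lambda>\<omega>. if chi i \<omega> \<in> S then - 1 else 1 :: real)"
    by (subst Bochner_Integration.integrable_cong[OF refl eq]) auto
  have "expectation (\<lambda>\<omega>. if chi i \<omega> \<in> S then - 1 else 1 :: real)
      = expectation (\<lambda>\<omega>. 1 - 2 * indicator ?A \<omega>)"
    by (intro Bochner_Integration.integral_cong refl eq)
  also have "\<dots> = 1 - 2 * prob ?A"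
    using A(1) ind by (subst Bochner_Integration.integral_diff) (auto simp: prob_space)
  finally show "expectation (\<lambda>\<omega>. if chi i \<omega> \<in> S then - 1 else 1) = 1 - 2 * sum p S"
    using A(2) by simp
qed

text \<open>
  Take expectations in \<open>ground_indicator_walsh\<close>. The factors of a character at different times are
  independent, each with mean \<open>1 - 2 * sum p S\<close>.
\<close>

lemma prob_first_bits_idle:
  "prob {\<omega> \<in> space M. \<forall>k\<in>{1..N}. bf_chain (\<lambda>i. chi i \<omega>) n k = 0} = walsh_return p N n"
    (is "prob ?A = _")
proof -
  have [measurable]: "(\<lambda>\<omega>. bf_chain (\<lambda>i. chi i \<omega>) n k) \<in> measurable M (count_space UNIV)" for k
    by (rule measurable_bf_chain, rule chi_measurable) auto
  have A: "?A \<in> events" by measurable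
  let ?s = "\<lambda>S i \<omega>. if chi i \<omega> \<in> S then - 1 else 1 :: real"
  have ind: "indep_vars (\<lambda>_. borel) (?s S) {1..n}" for S
    by (rule indep_vars_compose2[OF indep_vars_subset[OF indep], of _ "\<lambda>_ x. if x \<in> S then - 1 else 1"])
       auto
  have char: "integrable M (\<lambda>\<omega>. \<Prod>i=1..n. ?s S i \<omega>)"
             "expectation (\<lambda>\<omega>. \<Prod>i=1..n. ?s S i \<omega>) = (1 - 2 * sum p S) ^ n"
    if "S \<subseteq> {1..N}" for S
  proof -
    have S: "finite S" "S \<subseteq> {1..}" using that by (auto intro: finite_subset)
    show "integrable M (\<lambda>\<omega>. \<Prod>i=1..n. ?s S i \<omega>)"
      by (rule indep_vars_integrable[OF _ ind expectation_sign(1)]) (use S in auto)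
    have "expectation (\<lambda>\<omega>. \<Prod>i=1..n. ?s S i \<omega>) = (\<Prod>i=1..n. expectation (?s S i))"
      by (rule indep_vars_lebesgue_integral[OF _ ind expectation_sign(1)]) (use S in auto)
    also have "\<dots> = (1 - 2 * sum p S) ^ n"
      using expectation_sign(2)[OF _ S] by simp
    finally show "expectation (\<lambda>\<omega>. \<Prod>i=1..n. ?s S i \<omega>) = (1 - 2 * sum p S) ^ n" .
  qed
  have "prob ?A = expectation (indicator ?A)" using A by simp
  also have "\<dots> = expectation (\<lambda>\<omega>. (\<Sum>S\<in>Pow {1..N}. \<Prod>i=1..n. ?s S i \<omega>) / 2 ^ N)"
    by (intro Bochner_Integration.integral_cong refl, subst ground_indicator_walsh[symmetric])
       (auto simp: indicator_def)
  also have "\<dots> = walsh_return p N n"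
    unfolding walsh_return_def using char by (simp add: Bochner_Integration.integral_sum)
  finally show ?thesis .
qed

text \<open>
  Continuity from above in the number of observed bits. The left-hand side involves only \<open>p\<close>, so
  the limit is the same for every process of independent flips with law \<open>p\<close>.
\<close>

lemma walsh_return_tendsto:
  "(\<lambda>N. walsh_return p N n) \<longlonglongrightarrow> prob {\<omega> \<in> space M. at_ground (\<lambda>i. chi i \<omega>) n}"
proof -
  have [measurable]: "(\<lambda>\<omega>. bf_chain (\<lambda>i. chi i \<omega>) n k) \<in> measurable M (count_space UNIV)" for k
    by (rule measurable_bf_chain, rule chi_measurable) auto
  let ?A = "\<lambda>N. {\<omega> \<in> space M. \<forall>k\<in>{1..N}. bf_chain (\<lambda>i. chi i \<omega>) n k = 0}"
  have "(\<lambda>N. prob (?A N)) \<longlonglongrightarrow> prob (\<Inter>N. ?A N)"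
  proof (rule finite_Lim_measure_decseq)
    have "?A N \<in> events" for N by measurable
    then show "range ?A \<subseteq> events" by blast
    show "decseq ?A" unfolding decseq_def by auto
  qed
  also have "(\<Inter>N. ?A N) = {\<omega> \<in> space M. at_ground (\<lambda>i. chi i \<omega>) n}"
    unfolding at_ground_def by (auto, meson atLeastAtMost_iff order_refl)
  finally show ?thesis by (simp only: prob_first_bits_idle)
qed

lemma iid_flips_shift: "iid_flips M (\<lambda>i. chi (k + i)) p"
proof (unfold_locales)
  have "indep_vars (\<lambda>_. count_space {1..}) (\<lambda>i. chi (k + i)) {1..}"
    using indep_vars_reindex[of "\<lambda>i. k + i" "{1..}" "\<lambda>_. count_space {1..}" chi]
      indep_vars_subset[OF indep, of "(\<lambda>i. k + i) ` {1..}"]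
    by auto
  then show "indep_vars (\<lambda>_. count_space {1..}) (\<lambda>i. chi (k + i)) {1..}" .
  show "prob {\<omega> \<in> space M. chi (k + i) \<omega> = b} = p b" if "i \<ge> 1" "b \<ge> 1" for i b
    using that by (intro law) auto
qed

lemma prob_at_ground_shift:
  "prob {\<omega> \<in> space M. at_ground (\<lambda>i. chi (k + i) \<omega>) n}
     = prob {\<omega> \<in> space M. at_ground (\<lambda>i. chi i \<omega>) n}"
  by (rule LIMSEQ_unique[OF iid_flips.walsh_return_tendsto[OF iid_flips_shift] walsh_return_tendsto])

definition return_prob :: "nat \<Rightarrow> real" where
  "return_prob n = prob {\<omega> \<in> space M. at_ground (\<lambda>i. chi i \<omega>) n}"

definition first_return_prob :: "nat \<Rightarrow> real" where
  "first_return_prob n = prob {\<omega> \<in> space M. first_return (\<lambda>i. chi i \<omega>) n}"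

text \<open>
  The regeneration property: on a first return at time \<open>k\<close>, which is determined by the choices
  \<open>1..k\<close>, being at the ground at time \<open>k + m\<close> is an event about the choices \<open>k + 1..k + m\<close> alone.
\<close>

lemma prob_first_return_then_ground:
  "prob {\<omega> \<in> space M. first_return (\<lambda>i. chi i \<omega>) k \<and> at_ground (\<lambda>i. chi i \<omega>) (k + m)}
     = first_return_prob k * return_prob m"
proof -
  let ?C = "\<lambda>_::nat. count_space {1..} :: nat measure"
  let ?P = "{1..k}" and ?F = "{Suc k..k + m}"
  define X where "X = (\<lambda>\<omega>. restrict (\<lambda>i. chi i \<omega>) ?P)"
  define Y where "Y = (\<lambda>\<omega>. restrict (\<lambda>i. chi i \<omega>) ?F)"
  define U where "U = {x \<in> space (PiM ?P ?C). first_return x k}"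
  define V where "V = {x \<in> space (PiM ?F ?C). at_ground (\<lambda>i. x (k + i)) m}"
  have ind: "indep_var (PiM ?P ?C) X (PiM ?F ?C) Y"
    unfolding X_def Y_def by (rule indep_var_restrict[OF indep]) auto
  have U: "U \<in> sets (PiM ?P ?C)"
    unfolding U_def by (rule sets_first_return[of k "\<lambda>i x. x i"]) (rule measurable_component_singleton)
  have V: "V \<in> sets (PiM ?F ?C)"
    unfolding V_def
    by (rule sets_at_ground[of m "\<lambda>i x. x (k + i)"]) (rule measurable_component_singleton, auto)
  have X: "X \<omega> \<in> U \<longleftrightarrow> first_return (\<lambda>i. chi i \<omega>) k" if "\<omega> \<in> space M" for \<omega>
  proof -
    have "X \<omega> \<in> space (PiM ?P ?C)"
      using measurable_space[OF chi_measurable that] by (auto simp: X_def space_PiM)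
    moreover have "first_return (X \<omega>) k \<longleftrightarrow> first_return (\<lambda>i. chi i \<omega>) k"
      by (rule first_return_cong) (simp add: X_def)
    ultimately show ?thesis by (simp add: U_def)
  qed
  have Y: "Y \<omega> \<in> V \<longleftrightarrow> at_ground (\<lambda>i. chi (k + i) \<omega>) m" if "\<omega> \<in> space M" for \<omega>
  proof -
    have "Y \<omega> \<in> space (PiM ?F ?C)"
      using measurable_space[OF chi_measurable that] by (auto simp: Y_def space_PiM)
    moreover have "at_ground (\<lambda>i. Y \<omega> (k + i)) m \<longleftrightarrow> at_ground (\<lambda>i. chi (k + i) \<omega>) m"
      by (rule at_ground_cong) (simp add: Y_def)
    ultimately show ?thesis by (simp add: V_def)
  qed
  have "{\<omega> \<in> space M. first_return (\<lambda>i. chi i \<omega>) k \<and> at_ground (\<lambda>i. chi i \<omega>) (k + m)}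
      = {\<omega> \<in> space M. first_return (\<lambda>i. chi i \<omega>) k \<and> at_ground (\<lambda>i. chi (k + i) \<omega>) m}"
    by (auto simp: first_return_def at_ground_restart)
  also have "\<dots> = (\<lambda>\<omega>. (X \<omega>, Y \<omega>)) -` (U \<times> V) \<inter> space M"
    using X Y by auto
  also have "prob \<dots> = prob (X -` U \<inter> space M) * prob (Y -` V \<inter> space M)"
    by (rule indep_varD[OF ind U V])
  also have "X -` U \<inter> space M = {\<omega> \<in> space M. first_return (\<lambda>i. chi i \<omega>) k}"
    using X by auto
  also have "Y -` V \<inter> space M = {\<omega> \<in> space M. at_ground (\<lambda>i. chi (k + i) \<omega>) m}"
    using Y by auto
  finally show ?thesis
    by (simp add: first_return_prob_def return_prob_def prob_at_ground_shift)
qed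

lemma first_return_event: "{\<omega> \<in> space M. first_return (\<lambda>i. chi i \<omega>) n} \<in> events"
  by (rule sets_first_return, rule chi_measurable) auto

lemma at_ground_event: "{\<omega> \<in> space M. at_ground (\<lambda>i. chi i \<omega>) n} \<in> events"
  by (rule sets_at_ground, rule chi_measurable) auto

text \<open>
  Decompose according to the time of the first return.
\<close>

lemma return_prob_renewal:
  assumes "n \<ge> 1"
  shows "return_prob n = (\<Sum>k\<le>n. first_return_prob k * return_prob (n - k))"
proof -
  let ?B = "\<lambda>k. {\<omega> \<in> space M. first_return (\<lambda>i. chi i \<omega>) k \<and> at_ground (\<lambda>i. chi i \<omega>) n}"
  have "{\<omega> \<in> space M. at_ground (\<lambda>i. chi i \<omega>) n} = (\<Union>k\<in>{..n}. ?B k)"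
    using first_return_exists[OF assms] by auto
  then have "return_prob n = prob (\<Union>k\<in>{..n}. ?B k)"
    by (simp add: return_prob_def)
  also have "\<dots> = (\<Sum>k\<le>n. prob (?B k))"
  proof (rule finite_measure_finite_Union)
    show "?B ` {..n} \<subseteq> events"
      using sets.sets_Collect_conj[OF at_ground_event first_return_event] by blast
    show "disjoint_family_on ?B {..n}"
      unfolding disjoint_family_on_def using first_return_unique by blast
  qed simp
  also have "\<dots> = (\<Sum>k\<le>n. first_return_prob k * return_prob (n - k))"
  proof (rule sum.cong[OF refl])
    fix k assume "k \<in> {..n}"
    then show "prob (?B k) = first_return_prob k * return_prob (n - k)"
      using prob_first_return_then_ground[of k "n - k"] by simp
  qed
  finally show ?thesis .
qed

lemma first_return_prob_sums:
  "first_return_prob sums prob {\<omega> \<in> space M. bf_return_time (\<lambda>i. chi i \<omega>) < \<infinity>}"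
proof -
  have "(\<lambda>n. prob {\<omega> \<in> space M. first_return (\<lambda>i. chi i \<omega>) n})
      sums prob (\<Union>n. {\<omega> \<in> space M. first_return (\<lambda>i. chi i \<omega>) n})"
  proof (rule finite_measure_UNION)
    show "range (\<lambda>n. {\<omega> \<in> space M. first_return (\<lambda>i. chi i \<omega>) n}) \<subseteq> events"
      using first_return_event by blast
    show "disjoint_family (\<lambda>n. {\<omega> \<in> space M. first_return (\<lambda>i. chi i \<omega>) n})"
      unfolding disjoint_family_on_def using first_return_unique by blast
  qed
  moreover have "(\<Union>n. {\<omega> \<in> space M. first_return (\<lambda>i. chi i \<omega>) n})
      = {\<omega> \<in> space M. bf_return_time (\<lambda>i. chi i \<omega>) < \<infinity>}"
    unfolding return_time_finite_iff by blast
  ultimately show ?thesis by (simp add: first_return_prob_def[abs_def])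
qed

lemma finite_return_event:
  "{\<omega> \<in> space M. bf_return_time (\<lambda>i. chi i \<omega>) < \<infinity>} \<in> events"
  unfolding return_time_finite_iff
  by (rule sets.sets_Collect_countable_Ex) (rule first_return_event)

lemma recurrent_iff_return_prob_not_summable:
  "prob {\<omega> \<in> space M. bf_return_time (\<lambda>i. chi i \<omega>) < \<infinity>} = 1 \<longleftrightarrow> \<not> summable return_prob"
proof -
  have "suminf first_return_prob = prob {\<omega> \<in> space M. bf_return_time (\<lambda>i. chi i \<omega>) < \<infinity>}"
    using first_return_prob_sums by (rule sums_unique[symmetric])
  moreover have "suminf first_return_prob = 1 \<longleftrightarrow> \<not> summable return_prob"
  proof (rule renewal_recurrent_iff)
    show "return_prob 0 = 1" by (simp add: return_prob_def at_ground_0 prob_space)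
    show "first_return_prob 0 = 0" by (simp add: first_return_prob_def first_return_def)
    show "summable first_return_prob" using first_return_prob_sums by (rule sums_summable)
    show "suminf first_return_prob \<le> 1" by (simp add: calculation)
  qed (simp_all add: return_prob_renewal, simp_all add: return_prob_def first_return_prob_def)
  ultimately show ?thesis by simp
qed

lemma prob_return_time_infinite:
  "prob {\<omega> \<in> space M. bf_return_time (\<lambda>i. chi i \<omega>) = \<infinity>}
     = 1 - prob {\<omega> \<in> space M. bf_return_time (\<lambda>i. chi i \<omega>) < \<infinity>}"
proof -
  have "{\<omega> \<in> space M. bf_return_time (\<lambda>i. chi i \<omega>) = \<infinity>}
      = space M - {\<omega> \<in> space M. bf_return_time (\<lambda>i. chi i \<omega>) < \<infinity>}"
    by auto
  then show ?thesis using prob_compl[OF finite_return_event] by simp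
qed

end

section \<open>Fast decay of the weights\<close>

lemma sum_geometric_tail_le:
  assumes "finite S" "S \<subseteq> {Suc j..}"
  shows "(\<Sum>k\<in>S. (1 / 2 :: real) ^ k) \<le> (1 / 2) ^ j"
proof -
  have "(\<lambda>k. (1 / 2 :: real) ^ (k + Suc j)) sums ((1 / 2) ^ j)"
    using sums_mult[OF geometric_sums[of "1 / 2 :: real"], of "(1 / 2) ^ Suc j"]
    by (simp add: power_add mult.commute)
  have "(\<Sum>k\<in>S. (1 / 2 :: real) ^ k) = (\<Sum>i\<in>(\<lambda>k. k - Suc j) ` S. (1 / 2) ^ (i + Suc j))"
    by (rule sum.reindex_bij_witness[of _ "\<lambda>i. i + Suc j" "\<lambda>k. k - Suc j"])
       (use assms in \<open>auto simp: subset_iff simp del: add_Suc_right power_Suc\<close>)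
  also have "\<dots> \<le> (\<Sum>i. (1 / 2) ^ (i + Suc j))"
    by (rule sum_le_suminf) (use assms \<open>_ sums _\<close> in \<open>auto simp: sums_iff\<close>)
  also have "\<dots> = (1 / 2) ^ j"
    using \<open>_ sums _\<close> by (simp add: sums_iff)
  finally show ?thesis .
qed

text \<open>
  Keep only the sets \<open>S\<close> that avoid \<open>{1..j}\<close>; all terms are nonnegative because the exponent is
  even. These sets make up the proportion \<open>1 / 2 ^ j\<close>. Their weight is at most \<open>C / 2 ^ j\<close>, and
  Bernoulli's inequality bounds the corresponding terms from below.
\<close>

lemma walsh_return_even_lower:
  assumes nonneg: "\<And>k. k \<ge> 1 \<Longrightarrow> p k \<ge> 0"
    and decay: "\<And>k. k \<ge> 1 \<Longrightarrow> p k \<le> C * (1 / 2) ^ k"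
    and small: "2 * C \<le> 2 ^ j" and C: "C \<ge> 0" and "j \<le> N"
  shows "(1 - 4 * m * C / 2 ^ j) / 2 ^ j \<le> walsh_return p N (2 * m)"
proof -
  let ?T = "Pow {Suc j..N}"
  have char: "1 - 4 * m * C / 2 ^ j \<le> (1 - 2 * sum p S) ^ (2 * m)" if S: "S \<in> ?T" for S
  proof -
    have "finite S" using S by (auto intro: finite_subset)
    have "sum p S \<le> (\<Sum>k\<in>S. C * (1 / 2) ^ k)"
      using S by (intro sum_mono decay) auto
    also have "\<dots> \<le> C * (1 / 2) ^ j"
      unfolding sum_distrib_left[symmetric]
      by (intro mult_left_mono sum_geometric_tail_le C \<open>finite S\<close>) (use S in auto)
    finally have le: "sum p S \<le> C / 2 ^ j" by (simp add: power_divide)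
    have C2: "2 * (C / 2 ^ j) \<le> 1" using small by (simp add: field_simps)
    have "1 - 4 * m * C / 2 ^ j = 1 + of_nat (2 * m) * (- 2 * (C / 2 ^ j))" by simp
    also have "\<dots> \<le> (1 + (- 2 * (C / 2 ^ j))) ^ (2 * m)"
      by (rule Bernoulli_inequality) (use C2 in linarith)
    also have "\<dots> \<le> (1 - 2 * sum p S) ^ (2 * m)"
      by (rule power_mono) (use le C2 in linarith)+
    finally show ?thesis .
  qed
  have "real (card ?T) = 2 ^ N / 2 ^ j"
    using power_diff[OF _ \<open>j \<le> N\<close>, of "2::real"] by (simp only: card_Pow finite_atLeastAtMost) simp
  then have "(1 - 4 * m * C / 2 ^ j) / 2 ^ j = (\<Sum>S\<in>?T. 1 - 4 * m * C / 2 ^ j) / 2 ^ N"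
    by simp
  also have "\<dots> \<le> (\<Sum>S\<in>?T. (1 - 2 * sum p S) ^ (2 * m)) / 2 ^ N"
    by (intro divide_right_mono sum_mono char) auto
  also have "\<dots> \<le> (\<Sum>S\<in>Pow {1..N}. (1 - 2 * sum p S) ^ (2 * m)) / 2 ^ N"
    by (intro divide_right_mono sum_mono2) auto
  finally show ?thesis by (simp add: walsh_return_def)
qed

lemma not_summable_of_even_harmonic_lower:
  fixes u :: "nat \<Rightarrow> real"
  assumes "c > 0" and lower: "\<And>m. m \<ge> 1 \<Longrightarrow> c / m \<le> u (2 * m)" and nonneg: "\<And>n. u n \<ge> 0"
  shows "\<not> summable u"
proof
  assume "summable u"
  then have "summable (\<lambda>m. u (2 * m))"
    using summable_reindex[of u "\<lambda>m. 2 * m"] nonneg by (auto simp: inj_on_def comp_def)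
  then have "summable (\<lambda>m. c * inverse (real m))"
  proof (rule summable_comparison_test_ev[rotated])
    show "\<forall>\<^sub>F m in sequentially. norm (c * inverse (real m)) \<le> u (2 * m)"
      using lower \<open>c > 0\<close> by (intro eventually_sequentiallyI[of 1]) (simp add: divide_inverse)
  qed
  then show False
    using \<open>c > 0\<close> not_summable_harmonic[where 'a = real] by simp
qed

text \<open>
  The number \<open>j\<close> of avoided bits is adapted to the time \<open>2 * m\<close>: the least \<open>j\<close> with
  \<open>8 * m * C \<le> 2 ^ j\<close> makes the Bernoulli factor in \<open>walsh_return_even_lower\<close> at least \<open>1 / 2\<close>,
  while \<open>2 ^ j\<close> stays below \<open>16 * m * C\<close>.
\<close>

lemma (in iid_flips) return_prob_not_summable:
  assumes nonneg: "\<And>k. k \<ge> 1 \<Longrightarrow> p k \<ge> 0"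
    and decay: "\<And>k. k \<ge> 1 \<Longrightarrow> p k \<le> C * (1 / 2) ^ k" and C: "C \<ge> 1"
  shows "\<not> summable return_prob"
proof (rule not_summable_of_even_harmonic_lower)
  show "1 / (32 * C) > 0" using C by simp
  show "return_prob n \<ge> 0" for n by (simp add: return_prob_def)
  fix m :: nat assume m: "m \<ge> 1"
  define j where "j = (LEAST j. 8 * m * C \<le> 2 ^ j)"
  obtain j0 :: nat where "8 * m * C < 2 ^ j0" using real_arch_pow[of 2 "8 * m * C"] by auto
  then have "8 * m * C \<le> 2 ^ j0" by simp
  then have j: "8 * m * C \<le> 2 ^ j" unfolding j_def by (rule LeastI)
  have "1 * 1 \<le> real m * C" using m C by (intro mult_mono) auto
  then have big: "8 * m * C \<ge> 8" by simp
  have "j \<noteq> 0"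
  proof
    assume "j = 0"
    then have "8 * m * C \<le> 1" using j by simp
    with big show False by linarith
  qed
  then obtain i where i: "j = Suc i" by (cases j) auto
  have "\<not> 8 * m * C \<le> 2 ^ i" using i unfolding j_def by (intro not_less_Least) simp
  then have upper: "2 ^ j \<le> 16 * m * C" unfolding i power_Suc by linarith
  have "1 / (32 * C) / m \<le> (1 / 2) / 2 ^ j"
    using upper m C by (simp add: field_simps)
  also have "\<dots> \<le> (1 - 4 * m * C / 2 ^ j) / 2 ^ j"
    using j by (intro divide_right_mono) (auto simp: field_simps)
  also have "\<dots> \<le> return_prob (2 * m)"
    unfolding return_prob_def
  proof (rule LIMSEQ_le_const[OF walsh_return_tendsto])
    have "2 * C \<le> 8 * m * C" using m C by simp
    then have "2 * C \<le> 2 ^ j" using j by linarith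
    then have "(1 - 4 * m * C / 2 ^ j) / 2 ^ j \<le> walsh_return p N (2 * m)" if "j \<le> N" for N
      using walsh_return_even_lower[of p, OF nonneg decay] C that by simp
    then show "\<exists>N0. \<forall>N\<ge>N0. (1 - 4 * m * C / 2 ^ j) / 2 ^ j \<le> walsh_return p N (2 * m)"
      by blast
  qed
  finally show "1 / (32 * C) / m \<le> return_prob (2 * m)" .
qed

section \<open>Slow decay of the weights\<close>

text \<open>
  This is \<open>2 ^ N\<close> times the mean of \<open>1 / X\<close> on the event \<open>X > 0\<close>, where \<open>X\<close> is the weight of a
  uniformly random subset of \<open>{1..N}\<close>.
\<close>

definition inverse_subset_sum :: "(nat \<Rightarrow> real) \<Rightarrow> nat \<Rightarrow> real" where
  "inverse_subset_sum p N = (\<Sum>S\<in>Pow {1..N} - {{}}. 1 / sum p S)"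

lemma subset_sum_pos:
  fixes p :: "nat \<Rightarrow> real"
  assumes "\<And>k. k \<ge> 1 \<Longrightarrow> p k > 0" "S \<in> Pow {1..N} - {{}}"
  shows "sum p S > 0"
proof (rule sum_pos)
  show "finite S" using assms(2) by (auto intro: finite_subset)
qed (use assms in auto)

text \<open>
  Adding the element \<open>N + 1\<close> to a nonempty set only decreases the reciprocal of its weight; the
  singleton of \<open>N + 1\<close> is the one new set that does not come from a nonempty one. Dividing by
  \<open>2 ^ (N + 1)\<close> and iterating bounds the mean without any reference to the smallest element of \<open>S\<close>.
\<close>

lemma inverse_subset_sum_Suc:
  assumes pos: "\<And>k. k \<ge> 1 \<Longrightarrow> p k > 0"
  shows "inverse_subset_sum p (Suc N) \<le> 2 * inverse_subset_sum p N + 1 / p (Suc N)"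
proof -
  let ?A = "Pow {1..N} - {{}}" and ?ins = "insert (Suc N)"
  have eq: "Pow {1..Suc N} - {{}} = ?A \<union> ?ins ` Pow {1..N}"
    by (simp add: atLeastAtMostSuc_conv Pow_insert) auto
  have "inverse_subset_sum p (Suc N) = inverse_subset_sum p N + (\<Sum>S\<in>?ins ` Pow {1..N}. 1 / sum p S)"
    unfolding inverse_subset_sum_def eq by (rule sum.union_disjoint) auto
  also have "(\<Sum>S\<in>?ins ` Pow {1..N}. 1 / sum p S) = (\<Sum>S\<in>Pow {1..N}. 1 / sum p (?ins S))"
  proof (subst sum.reindex)
    have "S = ?ins S - {Suc N}" if "S \<in> Pow {1..N}" for S using that by auto
    then show "inj_on ?ins (Pow {1..N})" by (rule inj_on_inverseI[OF sym])
  qed (simp add: comp_def)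
  also have "\<dots> = 1 / p (Suc N) + (\<Sum>S\<in>?A. 1 / sum p (?ins S))"
    by (subst sum.remove[of _ "{}"]) auto
  also have "(\<Sum>S\<in>?A. 1 / sum p (?ins S)) \<le> inverse_subset_sum p N"
    unfolding inverse_subset_sum_def
  proof (rule sum_mono)
    fix S assume S: "S \<in> ?A"
    then have "finite S" "Suc N \<notin> S" by (auto intro: finite_subset)
    then have "sum p S \<le> sum p (?ins S)" using pos[of "Suc N"] by simp
    then show "1 / sum p (?ins S) \<le> 1 / sum p S"
      using subset_sum_pos[of p, OF pos S] by (intro divide_left_mono) auto
  qed
  finally show ?thesis by simp
qed

lemma inverse_subset_sum_le:
  assumes pos: "\<And>k. k \<ge> 1 \<Longrightarrow> p k > 0"
  shows "inverse_subset_sum p N \<le> 2 ^ N * (\<Sum>k=1..N. 1 / (2 ^ k * p k))"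
proof (induction N)
  case 0
  show ?case by (simp add: inverse_subset_sum_def)
next
  case (Suc N)
  have "inverse_subset_sum p (Suc N) \<le> 2 * inverse_subset_sum p N + 1 / p (Suc N)"
    by (rule inverse_subset_sum_Suc[OF pos])
  also have "\<dots> \<le> 2 * (2 ^ N * (\<Sum>k=1..N. 1 / (2 ^ k * p k))) + 1 / p (Suc N)"
    using Suc by simp
  also have "\<dots> = 2 ^ Suc N * (\<Sum>k=1..Suc N. 1 / (2 ^ k * p k))"
    by (simp add: algebra_simps)
  finally show ?case .
qed

text \<open>
  The geometric series is large both for \<open>x\<close> near 0 and, through its ratio near \<open>- 1\<close>, for \<open>x\<close> near
  1. Bounding it by the series of absolute values treats the two ends symmetrically and avoids
  separating even from odd times.
\<close>

lemma geometric_sum_character_le: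
  fixes x :: real
  assumes "0 < x" "x < 1"
  shows "(\<Sum>n<L. (1 - 2 * x) ^ n) \<le> 1 / x + 1 / (1 - x)"
proof -
  let ?y = "\<bar>1 - 2 * x\<bar>"
  have y: "?y < 1" using assms by auto
  have "(\<Sum>n<L. (1 - 2 * x) ^ n) \<le> (\<Sum>n<L. ?y ^ n)"
    by (intro sum_mono) (simp add: power_abs[symmetric])
  also have "\<dots> \<le> 1 / (1 - ?y)"
    using sum_le_suminf[of "\<lambda>n. ?y ^ n" "{..<L}"] y by (simp add: suminf_geometric summable_geometric)
  also have "\<dots> \<le> 1 / x + 1 / (1 - x)"
  proof (cases "2 * x \<le> 1")
    case True
    then have "1 / (1 - ?y) \<le> 1 / x" using assms by (intro divide_left_mono) auto
    moreover have "0 \<le> 1 / (1 - x)" using assms by simp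
    ultimately show ?thesis by linarith
  next
    case False
    then have "1 / (1 - ?y) \<le> 1 / (1 - x)" using assms by (intro divide_left_mono) auto
    moreover have "0 \<le> 1 / x" using assms by simp
    ultimately show ?thesis by linarith
  qed
  finally show ?thesis .
qed

text \<open>
  The empty set contributes \<open>L\<close>, which the factor \<open>1 / 2 ^ N\<close> later suppresses. For the other sets
  \<open>geometric_sum_character_le\<close> applies. The term with \<open>1 - sum p S\<close> reduces to the first one by
  complementation; the complement is taken in \<open>{1..Suc N}\<close> so that it is nonempty
  even for \<open>S = {1..N}\<close>. The constant 3 is 1 from the sets and 2 from their complements, which
  range over subsets of a set with one more element.
\<close>

lemma walsh_return_partial_sum_le:
  assumes pos: "\<And>k. k \<ge> 1 \<Longrightarrow> p k > 0"
    and mass: "\<And>S. finite S \<Longrightarrow> S \<subseteq> {1..} \<Longrightarrow> sum p S \<le> 1"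
    and K: "\<And>N. (\<Sum>k=1..N. 1 / (2 ^ k * p k)) \<le> K"
  shows "(\<Sum>n<L. walsh_return p N n) \<le> L / 2 ^ N + 3 * K"
proof -
  let ?A = "Pow {1..N} - {{}}" and ?co = "\<lambda>S. {1..Suc N} - S"
  have inv: "inverse_subset_sum p n \<le> 2 ^ n * K" for n
  proof (rule order_trans)
    show "inverse_subset_sum p n \<le> 2 ^ n * (\<Sum>k=1..n. 1 / (2 ^ k * p k))"
      by (rule inverse_subset_sum_le[OF pos])
    show "2 ^ n * (\<Sum>k=1..n. 1 / (2 ^ k * p k)) \<le> 2 ^ n * K"
      by (intro mult_left_mono K) simp
  qed
  have co: "0 < sum p (?co S)" "sum p (?co S) \<le> 1 - sum p S" if "S \<in> ?A" for S
  proof -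
    have S: "S \<subseteq> {1..Suc N}" "Suc N \<notin> S" using that by auto
    show "0 < sum p (?co S)"
      using S by (intro subset_sum_pos[of p, OF pos]) auto
    have "sum p (?co S) + sum p S = sum p {1..Suc N}"
      by (rule sum.subset_diff[symmetric]) (use S in auto)
    then show "sum p (?co S) \<le> 1 - sum p S"
      using mass[of "{1..Suc N}"] by simp
  qed
  have "(\<Sum>n<L. (1 - 2 * sum p S) ^ n) \<le> 1 / sum p S + 1 / sum p (?co S)" if S: "S \<in> ?A" for S
  proof -
    have "0 < sum p S" by (rule subset_sum_pos[of p, OF pos S])
    then have "(\<Sum>n<L. (1 - 2 * sum p S) ^ n) \<le> 1 / sum p S + 1 / (1 - sum p S)"
      using co[OF S] by (intro geometric_sum_character_le) linarith+
    also have "1 / (1 - sum p S) \<le> 1 / sum p (?co S)"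
      using co[OF S] by (intro divide_left_mono mult_pos_pos) linarith+
    finally show ?thesis by simp
  qed
  then have "(\<Sum>S\<in>?A. \<Sum>n<L. (1 - 2 * sum p S) ^ n) \<le> (\<Sum>S\<in>?A. 1 / sum p S + 1 / sum p (?co S))"
    by (rule sum_mono)
  also have "\<dots> = inverse_subset_sum p N + (\<Sum>S\<in>?A. 1 / sum p (?co S))"
    by (simp add: inverse_subset_sum_def sum.distrib)
  also have "(\<Sum>S\<in>?A. 1 / sum p (?co S)) = (\<Sum>S\<in>?co ` ?A. 1 / sum p S)"
  proof (subst sum.reindex)
    have "S = {1..Suc N} - ?co S" if "S \<in> ?A" for S using that by auto
    then show "inj_on ?co ?A" by (rule inj_on_inverseI[OF sym])
  qed (simp add: comp_def)
  also have "\<dots> \<le> inverse_subset_sum p (Suc N)"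
    unfolding inverse_subset_sum_def
  proof (rule sum_mono2)
    have "Suc N \<in> ?co S" if "S \<in> ?A" for S using that by auto
    then show "?co ` ?A \<subseteq> Pow {1..Suc N} - {{}}" by blast
    show "0 \<le> 1 / sum p S" if "S \<in> Pow {1..Suc N} - {{}} - ?co ` ?A" for S
      using subset_sum_pos[of p S "Suc N", OF pos] that by (simp add: less_imp_le)
  qed simp
  also have "inverse_subset_sum p N + inverse_subset_sum p (Suc N) \<le> 2 ^ N * (3 * K)"
    using inv[of N] inv[of "Suc N"] by simp
  finally have "(\<Sum>S\<in>?A. \<Sum>n<L. (1 - 2 * sum p S) ^ n) \<le> 2 ^ N * (3 * K)" by simp
  moreover have "(\<Sum>n<L. walsh_return p N n) = (\<Sum>S\<in>Pow {1..N}. \<Sum>n<L. (1 - 2 * sum p S) ^ n) / 2 ^ N"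
    unfolding walsh_return_def sum_divide_distrib[symmetric] by (subst sum.swap) simp
  moreover have "(\<Sum>S\<in>Pow {1..N}. \<Sum>n<L. (1 - 2 * sum p S) ^ n)
      = L + (\<Sum>S\<in>?A. \<Sum>n<L. (1 - 2 * sum p S) ^ n)"
    by (subst sum.remove[of _ "{}"]) auto
  ultimately show ?thesis by (simp add: field_simps)
qed

text \<open>
  In \<open>walsh_return_partial_sum_le\<close> the time horizon is fixed while the number of bits tends to
  infinity, which removes the contribution of the empty set.
\<close>

lemma (in iid_flips) return_prob_summable:
  assumes pos: "\<And>k. k \<ge> 1 \<Longrightarrow> p k > 0"
    and summ: "summable (\<lambda>k. 1 / (2 ^ k * p k))"
  shows "summable return_prob"
proof -
  have mass: "sum p S \<le> 1" if "finite S" "S \<subseteq> {1..}" for S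
    using prob_chi_in(2)[of 1 S] that by (metis order_refl prob_le_1)
  define K where "K = (\<Sum>k. 1 / (2 ^ Suc k * p (Suc k)))"
  have K: "(\<Sum>k=1..N. 1 / (2 ^ k * p k)) \<le> K" for N
  proof -
    have "(\<Sum>k=1..N. 1 / (2 ^ k * p k)) = (\<Sum>k<N. 1 / (2 ^ Suc k * p (Suc k)))"
      by (rule sum.reindex_bij_witness[of _ Suc "\<lambda>k. k - 1"]) auto
    also have "\<dots> \<le> K"
      unfolding K_def using summ pos
      by (intro sum_le_suminf) (auto simp: summable_Suc_iff[where f = "\<lambda>k. 1 / (2 ^ k * p k)"] less_imp_le
          simp del: power_Suc)
    finally show ?thesis .
  qed
  show ?thesis
  proof (rule bounded_imp_summable)
    show "return_prob n \<ge> 0" for n by (simp add: return_prob_def)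
    fix n
    have lim: "(\<lambda>N. \<Sum>i<Suc n. walsh_return p N i) \<longlonglongrightarrow> (\<Sum>i<Suc n. return_prob i)"
      unfolding return_prob_def by (intro tendsto_sum walsh_return_tendsto)
    have lim': "(\<lambda>N. Suc n / 2 ^ N + 3 * K) \<longlonglongrightarrow> 0 + 3 * K"
      by (intro tendsto_add tendsto_const LIMSEQ_divide_realpow_zero) auto
    have "(\<Sum>i<Suc n. return_prob i) \<le> 0 + 3 * K"
      by (rule LIMSEQ_le[OF lim lim']) (use walsh_return_partial_sum_le[OF pos mass K] in blast)
    then show "(\<Sum>i\<le>n. return_prob i) \<le> 3 * K"
      by (simp add: lessThan_Suc_atMost)
  qed
qed

lemma decay_of_limsup:
  fixes p :: "nat \<Rightarrow> real"
  assumes "limsup (\<lambda>k. ereal (2 ^ k * p k)) < \<infinity>"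
  obtains C where "C \<ge> 1" "\<And>k. p k \<le> C * (1 / 2) ^ k"
proof -
  obtain B :: real where "limsup (\<lambda>k. ereal (2 ^ k * p k)) < ereal B"
    using less_PInf_Ex_of_nat[of "limsup (\<lambda>k. ereal (2 ^ k * p k))"] assms by auto
  then have "eventually (\<lambda>k. ereal (2 ^ k * p k) < ereal B) sequentially"
    by (rule Limsup_lessD)
  then obtain k0 where k0: "\<And>k. k \<ge> k0 \<Longrightarrow> 2 ^ k * p k < B"
    by (auto simp: eventually_sequentially)
  define C where "C = Max (insert 1 (insert B ((\<lambda>k. 2 ^ k * p k) ` {..<k0})))"
  have "2 ^ k * p k \<le> C" for k
  proof (cases "k < k0")
    case True
    then show ?thesis unfolding C_def by (intro Max_ge) auto
  next
    case False
    then have "2 ^ k * p k \<le> B" using k0[of k] by simp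
    also have "B \<le> C" unfolding C_def by (intro Max_ge) auto
    finally show ?thesis .
  qed
  then have "p k \<le> C * (1 / 2) ^ k" for k
    by (simp add: field_simps)
  moreover have "C \<ge> 1" unfolding C_def by (intro Max_ge) auto
  ultimately show thesis using that by blast
qed

text \<open>
  The base \<open>2 - \<epsilon>\<close> is positive, since otherwise the odd powers would make the sequence nonpositive
  infinitely often. So \<open>1 / (2 ^ k * p k)\<close> is eventually dominated by a multiple of the geometric
  sequence with ratio \<open>(2 - \<epsilon>) / 2 < 1\<close>.
\<close>

lemma summable_of_liminf:
  fixes p :: "nat \<Rightarrow> real"
  assumes pos: "\<And>k. k \<ge> 1 \<Longrightarrow> p k > 0" and "\<epsilon> > 0"
    and liminf: "liminf (\<lambda>k. ereal ((2 - \<epsilon>) ^ k * p k)) > 0"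
  shows "summable (\<lambda>k. 1 / (2 ^ k * p k))"
proof -
  obtain c where c: "0 < ereal c" "ereal c < liminf (\<lambda>k. ereal ((2 - \<epsilon>) ^ k * p k))"
    using ereal_dense2[OF liminf] by auto
  have "eventually (\<lambda>k. ereal c < ereal ((2 - \<epsilon>) ^ k * p k)) sequentially"
    using c(2) by (rule less_LiminfD)
  then obtain k0 where k0: "\<And>k. k \<ge> k0 \<Longrightarrow> c < (2 - \<epsilon>) ^ k * p k"
    by (auto simp: eventually_sequentially)
  have c0: "c > 0" using c(1) by simp
  have base: "2 - \<epsilon> > 0"
  proof (rule ccontr)
    assume neg: "\<not> 2 - \<epsilon> > 0"
    \<comment> \<open>an odd index beyond \<open>k0\<close>\<close>
    let ?k = "2 * k0 + 1"
    have "(2 - \<epsilon>) ^ ?k \<le> 0"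
      using neg by (simp add: power_mult mult_nonpos_nonneg)
    then have "(2 - \<epsilon>) ^ ?k * p ?k \<le> 0"
      using pos[of ?k] by (intro mult_nonpos_nonneg) auto
    with k0[of ?k] c0 show False by simp
  qed
  have "summable (\<lambda>k. 1 / c * ((2 - \<epsilon>) / 2) ^ k)"
    using base \<open>\<epsilon> > 0\<close> by (intro summable_mult summable_geometric) simp
  then show ?thesis
  proof (rule summable_comparison_test_ev[rotated])
    show "eventually (\<lambda>k. norm (1 / (2 ^ k * p k)) \<le> 1 / c * ((2 - \<epsilon>) / 2) ^ k) sequentially"
    proof (rule eventually_sequentiallyI[of "max 1 k0"])
      fix k assume k: "max 1 k0 \<le> k"
      have p: "p k > 0" using k pos by simp
      have "c \<le> (2 - \<epsilon>) ^ k * p k" using k0[of k] k by simp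
      then have "1 / p k \<le> (2 - \<epsilon>) ^ k / c" using p c0 by (simp add: field_simps)
      then have "1 / p k / 2 ^ k \<le> (2 - \<epsilon>) ^ k / c / 2 ^ k"
        by (rule divide_right_mono) simp
      then show "norm (1 / (2 ^ k * p k)) \<le> 1 / c * ((2 - \<epsilon>) / 2) ^ k"
        using p by (simp add: power_divide mult.commute)
    qed
  qed
qed

lemma decreasing_unbounded_support_pos:
  fixes p :: "nat \<Rightarrow> real"
  assumes dec: "\<And>k. k \<ge> 1 \<Longrightarrow> p (Suc k) \<le> p k"
    and unb: "\<not> bdd_above {k. k \<ge> 1 \<and> p k > 0}" and "k \<ge> 1"
  shows "p k > 0"
proof -
  obtain n where n: "n \<ge> k" "p n > 0"
    using unb unfolding bdd_above_def by (metis (mono_tags, lifting) mem_Collect_eq nat_le_linear)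
  from n(1) have "p n \<le> p k"
    by (induction rule: dec_induct) (use dec \<open>k \<ge> 1\<close> in \<open>auto intro: order_trans\<close>)
  with n(2) show ?thesis by simp
qed

theorem theorem2p1:
  fixes M :: "'a measure" and chi :: "nat \<Rightarrow> 'a \<Rightarrow> nat" and p :: "nat \<Rightarrow> real"
  assumes p_nonneg: "\<And>k. k \<ge> 1 \<Longrightarrow> p k \<ge> 0"
    and p_sum: "(p has_sum 1) {1..}"
    and p_decreasing: "\<And>k. k \<ge> 1 \<Longrightarrow> p (Suc k) \<le> p k"
    and p_unbounded_support: "\<not> bdd_above {k. k \<ge> 1 \<and> p k > 0}"
    and prob_space: "prob_space M"
    and indep: "prob_space.indep_vars M (\<lambda>_. count_space {1..}) chi {1..}"
    and law: "\<And>i k. i \<ge> 1 \<Longrightarrow> k \<ge> 1 \<Longrightarrow> measure M {\<omega> \<in> space M. chi i \<omega> = k} = p k"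
  shows "(limsup (\<lambda>k. ereal (2 ^ k * p k)) < \<infinity> \<longrightarrow>
            measure M {\<omega> \<in> space M. bf_return_time (\<lambda>i. chi i \<omega>) < \<infinity>} = 1)
       \<and> ((\<exists>\<epsilon>::real>0. liminf (\<lambda>k. ereal ((2 - \<epsilon>) ^ k * p k)) > 0) \<longrightarrow>
            measure M {\<omega> \<in> space M. bf_return_time (\<lambda>i. chi i \<omega>) = \<infinity>} > 0)"
proof (intro conjI impI)
  interpret prob_space M by (rule prob_space)
  interpret iid_flips M chi p by unfold_locales (use indep law in auto)
  let ?finite = "measure M {\<omega> \<in> space M. bf_return_time (\<lambda>i. chi i \<omega>) < \<infinity>}"
  have pos: "p k > 0" if "k \<ge> 1" for k
    by (rule decreasing_unbounded_support_pos[OF p_decreasing p_unbounded_support that])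
  show "?finite = 1" if lim: "limsup (\<lambda>k. ereal (2 ^ k * p k)) < \<infinity>"
  proof -
    obtain C where "C \<ge> 1" "\<And>k. p k \<le> C * (1 / 2) ^ k"
      using decay_of_limsup[OF lim] by blast
    then show ?thesis
      unfolding recurrent_iff_return_prob_not_summable
      by (intro return_prob_not_summable p_nonneg)
  qed
  show "measure M {\<omega> \<in> space M. bf_return_time (\<lambda>i. chi i \<omega>) = \<infinity>} > 0"
    if ex: "\<exists>\<epsilon>::real>0. liminf (\<lambda>k. ereal ((2 - \<epsilon>) ^ k * p k)) > 0"
  proof -
    obtain \<epsilon> :: real where eps: "\<epsilon> > 0" "liminf (\<lambda>k. ereal ((2 - \<epsilon>) ^ k * p k)) > 0"
      using ex by blast
    have "summable (\<lambda>k. 1 / (2 ^ k * p k))"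
      by (rule summable_of_liminf[OF pos eps])
    then have "?finite \<noteq> 1"
      unfolding recurrent_iff_return_prob_not_summable using return_prob_summable[OF pos] by simp
    then show ?thesis
      using prob_return_time_infinite prob_le_1[of "{\<omega> \<in> space M. bf_return_time (\<lambda>i. chi i \<omega>) < \<infinity>}"]
      by linarith
  qed
qed

end
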